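(* Let $G$ be a prereduced graph and $W$ an induced subgraph of $G$ that is a $\dagger$- or $\ddagger$-AW with shallow terminal $s$ and base $B$. Let $C=N(s)\cap N(B)$ and let $M$ be the vertex set of the connected component of $G-C$ containing $s$. Then every vertex of $M$ is adjacent to every vertex of $C$, and $G[C]$ is a clique.
   Context: Graphs are finite, simple, undirected. For $U\subseteq V(G)$, $N(U)=\bigcup_{v\in U}N[v]\setminus U$. A minimal forbidden set is $X\subseteq V(G)$ with $G[X]$ not an interval graph but every proper subset inducing an interval graph; $G$ is prereduced if it has no minimal forbidden set of at most $10$ vertices. A $\dagger$-AW $(s:c:l,B,r)$, $B=\{b_1,\dots,b_d\}$, $d\ge 3$, $b_0=l$, $b_{d+1}=r$: vertices $s,c,b_0,\dots,b_{d+1}$ with edges exactly $b_ib_{i+1}$ $(0\le i\le d)$, $cs$, $cb_i$ $(1\le i\le d)$. A $\ddagger$-AW $(s:c_1,c_2:l,B,r)$, $d\ge 2$: vertices $s,c_1,c_2,b_0,\dots,b_{d+1}$ with edges exactly $b_ib_{i+1}$, $c_1c_2$, $c_1s$, $c_2s$, $c_1l$, $c_2r$, $c_jb_i$ ($j=1,2$, $1\le i\le d$). Here $s$ is the shallow terminal and $B$ the base. *)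

theory Defs
  imports "Graph_Theory.Graph_Theory"
begin

text \<open>
  Finite simple undirected graphs are the digraphs of the locale \<open>graph\<close>: finite, without loops and
  parallel arcs, and symmetric, so that \<open>u \<rightarrow>\<^bsub>G\<^esub> v\<close> is adjacency and every edge is a pair of opposite
  arcs. \<open>G \<restriction> U\<close> is \<open>G[U]\<close>.
\<close>

definition closed_neighbourhood :: "('a,'b) pre_digraph \<Rightarrow> 'a \<Rightarrow> 'a set" where
  "closed_neighbourhood G v = insert v {u. v \<rightarrow>\<^bsub>G\<^esub> u}"

definition neighbourhood :: "('a,'b) pre_digraph \<Rightarrow> 'a set \<Rightarrow> 'a set" where
  "neighbourhood G U = (\<Union>v\<in>U. closed_neighbourhood G v) - U"

definition interval_graph :: "('a,'b) pre_digraph \<Rightarrow> bool" where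
  "interval_graph G \<longleftrightarrow> (\<exists>lo hi :: 'a \<Rightarrow> real.
     (\<forall>v \<in> verts G. lo v \<le> hi v) \<and>
     (\<forall>u \<in> verts G. \<forall>v \<in> verts G. u \<noteq> v \<longrightarrow>
        (u \<rightarrow>\<^bsub>G\<^esub> v \<longleftrightarrow> {lo u..hi u} \<inter> {lo v..hi v} \<noteq> {})))"

definition minimal_forbidden_set :: "('a,'b) pre_digraph \<Rightarrow> 'a set \<Rightarrow> bool" where
  "minimal_forbidden_set G X \<longleftrightarrow>
     X \<subseteq> verts G \<and> \<not> interval_graph (G \<restriction> X) \<and> (\<forall>Y. Y \<subset> X \<longrightarrow> interval_graph (G \<restriction> Y))"

definition prereduced :: "('a,'b) pre_digraph \<Rightarrow> bool" where
  "prereduced G \<longleftrightarrow> \<not> (\<exists>X. minimal_forbidden_set G X \<and> card X \<le> 10)"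

text \<open>
  In the next two definitions \<open>b 0, \<dots>, b (d + 1)\<close> is the path from \<open>l\<close> to \<open>r\<close>; the listed vertices are
  pairwise distinct, and \<open>E\<close> holds each edge in one orientation.
\<close>

definition dagger_AW ::
  "('a,'b) pre_digraph \<Rightarrow> 'a \<Rightarrow> 'a \<Rightarrow> 'a \<Rightarrow> 'a set \<Rightarrow> 'a \<Rightarrow> bool" where
  "dagger_AW W s c l B r \<longleftrightarrow> (\<exists>(d::nat) b. d \<ge> 3 \<and>
     l = b 0 \<and> B = b ` {1..d} \<and> r = b (d + 1) \<and>
     inj_on b {0..d + 1} \<and> distinct [s, c] \<and> {s, c} \<inter> b ` {0..d + 1} = {} \<and>
     verts W = {s, c} \<union> b ` {0..d + 1} \<and>
     (let E = {(b i, b (i + 1)) | i. i \<le> d} \<union> {(c, s)} \<union> {(c, b i) | i. i \<in> {1..d}}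
      in arcs_ends W = E \<union> E\<inverse>))"

definition ddagger_AW ::
  "('a,'b) pre_digraph \<Rightarrow> 'a \<Rightarrow> 'a \<Rightarrow> 'a \<Rightarrow> 'a \<Rightarrow> 'a set \<Rightarrow> 'a \<Rightarrow> bool" where
  "ddagger_AW W s c\<^sub>1 c\<^sub>2 l B r \<longleftrightarrow> (\<exists>(d::nat) b. d \<ge> 2 \<and>
     l = b 0 \<and> B = b ` {1..d} \<and> r = b (d + 1) \<and>
     inj_on b {0..d + 1} \<and> distinct [s, c\<^sub>1, c\<^sub>2] \<and> {s, c\<^sub>1, c\<^sub>2} \<inter> b ` {0..d + 1} = {} \<and>
     verts W = {s, c\<^sub>1, c\<^sub>2} \<union> b ` {0..d + 1} \<and>
     (let E = {(b i, b (i + 1)) | i. i \<le> d} \<union> {(c\<^sub>1, c\<^sub>2), (c\<^sub>1, s), (c\<^sub>2, s), (c\<^sub>1, l), (c\<^sub>2, r)}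
            \<union> {(c, b i) | c i. c \<in> {c\<^sub>1, c\<^sub>2} \<and> i \<in> {1..d}}
      in arcs_ends W = E \<union> E\<inverse>))"

text \<open>Components are the maximal connected subgraphs.\<close>

definition is_component :: "('a,'b) pre_digraph \<Rightarrow> ('a,'b) pre_digraph \<Rightarrow> bool" where
  "is_component G K \<longleftrightarrow> pre_digraph.max_subgraph G connected K"

definition is_clique :: "('a,'b) pre_digraph \<Rightarrow> bool" where
  "is_clique G \<longleftrightarrow> (\<forall>u \<in> verts G. \<forall>v \<in> verts G. u \<noteq> v \<longrightarrow> u \<rightarrow>\<^bsub>G\<^esub> v)"

end

theory Submission
  imports Defs
begin

text \<open>
  By prereducedness, at most ten vertices never carry a hole or an asteroidal triple. Fix a common
  neighbour \<open>x\<close> of the shallow terminal \<open>s\<close> and the base, and a neighbour \<open>m \<noteq> x\<close> of \<open>s\<close> that misses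
  \<open>x\<close>. Then \<open>m\<close> sees neither the neighbours of \<open>x\<close> on the path \<open>l, B, r\<close> nor the path vertices next to
  them. The first and the last neighbour of \<open>x\<close> on the path, the vertices just outside them (replaced
  by the centres where \<open>x\<close> reaches an end of the path), \<open>x\<close>, \<open>s\<close> and \<open>m\<close> then carry a small asteroidal
  triple; if \<open>x\<close> has only one neighbour there, the path vertices within distance two of it serve
  instead. So every \<open>x \<in> C\<close> is adjacent to all other neighbours of \<open>s\<close>; in particular \<open>C\<close> is a clique.
  Moreover a neighbour \<open>m \<notin> C\<close> of \<open>s\<close> can replace \<open>s\<close> as shallow terminal, with the same \<open>C\<close>, and the
  claim spreads over the component.
\<close>

section \<open>Induced subgraphs, minimal forbidden sets and interval models\<close>

lemma (in wf_digraph) adj_induce_subgraph_iff: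
  "u \<rightarrow>\<^bsub>G \<restriction> X\<^esub> v \<longleftrightarrow> u \<in> X \<and> v \<in> X \<and> u \<rightarrow>\<^bsub>G\<^esub> v"
  by (auto simp: arcs_ends_conv image_iff)

lemma (in wf_digraph) induced_subgraph_adj_iff:
  assumes "induced_subgraph H G" "u \<in> verts H" "v \<in> verts H"
  shows "u \<rightarrow>\<^bsub>H\<^esub> v \<longleftrightarrow> u \<rightarrow>\<^bsub>G\<^esub> v"
proof -
  have "compatible G H" "arcs H = {e \<in> arcs G. tail G e \<in> verts H \<and> head G e \<in> verts H}"
    using assms by (auto simp: induced_subgraph_def)
  then show ?thesis
    using assms(2,3) by (auto simp: arcs_ends_conv image_iff compatible_def)
qed

text \<open>Prereducedness speaks of minimal forbidden sets only. Descent through proper subsets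
  that are still not interval carries it over to every small vertex set.\<close>

lemma minimal_forbidden_subset:
  assumes "finite X" "X \<subseteq> verts G" "\<not> interval_graph (G \<restriction> X)"
  shows "\<exists>Y \<subseteq> X. minimal_forbidden_set G Y"
  using assms
proof (induction rule: finite_psubset_induct)
  case (psubset X)
  show ?case
  proof (cases "minimal_forbidden_set G X")
    case False
    then obtain Y where "Y \<subset> X" "\<not> interval_graph (G \<restriction> Y)"
      using psubset.prems by (auto simp: minimal_forbidden_set_def)
    with psubset.IH[of Y] psubset.prems show ?thesis by blast
  qed blast
qed

text \<open>The walks of an asteroidal triple: two of its vertices are joined outside the closed
  neighbourhood of the third. Vertices may repeat, so a concrete list is checked entry by
  entry.\<close>

definition avoiding_walk :: "('a,'b) pre_digraph \<Rightarrow> 'a \<Rightarrow> 'a list \<Rightarrow> 'a \<Rightarrow> 'a \<Rightarrow> bool" where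
  "avoiding_walk G z p u v \<longleftrightarrow> p \<noteq> [] \<and> hd p = u \<and> last p = v \<and> successively (dominates G) p \<and>
     (\<forall>y \<in> set p. y \<noteq> z \<and> \<not> y \<rightarrow>\<^bsub>G\<^esub> z)"

text \<open>Intersection is spelled out as a comparison of endpoints, which linear arithmetic can
  use, and adjacency is taken in \<open>G\<close> itself.\<close>

definition interval_model :: "('a,'b) pre_digraph \<Rightarrow> 'a set \<Rightarrow> ('a \<Rightarrow> real) \<Rightarrow> ('a \<Rightarrow> real) \<Rightarrow> bool" where
  "interval_model G X lo hi \<longleftrightarrow> (\<forall>v \<in> X. lo v \<le> hi v) \<and>
     (\<forall>u \<in> X. \<forall>v \<in> X. u \<noteq> v \<longrightarrow> (u \<rightarrow>\<^bsub>G\<^esub> v \<longleftrightarrow> lo u \<le> hi v \<and> lo v \<le> hi u))"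

lemma interval_model_le: "interval_model G X lo hi \<Longrightarrow> v \<in> X \<Longrightarrow> lo v \<le> hi v"
  by (simp add: interval_model_def)

lemma interval_model_adj:
  "interval_model G X lo hi \<Longrightarrow> u \<in> X \<Longrightarrow> v \<in> X \<Longrightarrow> u \<noteq> v \<Longrightarrow> u \<rightarrow>\<^bsub>G\<^esub> v \<Longrightarrow>
    lo u \<le> hi v \<and> lo v \<le> hi u"
  by (simp add: interval_model_def)

lemma interval_model_not_adj:
  "interval_model G X lo hi \<Longrightarrow> u \<in> X \<Longrightarrow> v \<in> X \<Longrightarrow> u \<noteq> v \<Longrightarrow> \<not> u \<rightarrow>\<^bsub>G\<^esub> v \<Longrightarrow>
    hi u < lo v \<or> hi v < lo u"
  by (auto simp: interval_model_def not_le)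

text \<open>Each interval of the list misses \<open>[L, H]\<close> and so lies on one side of it.
  Consecutive intervals meet, which intervals on opposite sides cannot do.\<close>

lemma successively_same_side:
  fixes lo hi :: "'a \<Rightarrow> real"
  assumes "successively E p" "p \<noteq> []"
    and "\<And>y y'. y \<in> set p \<Longrightarrow> y' \<in> set p \<Longrightarrow> E y y' \<Longrightarrow> lo y \<le> hi y' \<and> lo y' \<le> hi y"
    and "\<And>y. y \<in> set p \<Longrightarrow> lo y \<le> hi y \<and> (hi y < L \<or> H < lo y)"
    and "L \<le> H"
  shows "hi (hd p) < L \<longleftrightarrow> hi (last p) < L"
  using assms
proof (induction p rule: induct_list012)
  case (3 y y' p)
  have "hi (hd (y' # p)) < L \<longleftrightarrow> hi (last (y' # p)) < L"
    using 3(3,5,6,7) by (intro 3(2)) auto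
  moreover have "lo y \<le> hi y'" "lo y' \<le> hi y" using 3(3,5) by auto
  then have "hi y < L \<longleftrightarrow> hi y' < L"
    using 3(6)[of y] 3(6)[of y'] \<open>L \<le> H\<close> by (cases "hi y < L"; cases "hi y' < L") simp_all
  ultimately show ?case by simp
qed auto

section \<open>Small holes and asteroidal triples are excluded\<close>

locale prereduced_graph = graph G for G :: "('a,'b) pre_digraph" (structure) +
  assumes prereduced: "prereduced G"
begin

lemma adj_sym: "u \<rightarrow>\<^bsub>G\<^esub> v \<longleftrightarrow> v \<rightarrow>\<^bsub>G\<^esub> u"
  using sym_arcs by (auto simp: symmetric_def sym_def)

lemma adj_symD: "u \<rightarrow>\<^bsub>G\<^esub> v \<Longrightarrow> v \<rightarrow>\<^bsub>G\<^esub> u"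
  by (simp add: adj_sym)

lemma adj_irrefl [simp]: "\<not> u \<rightarrow>\<^bsub>G\<^esub> u"
  using adj_not_same by blast

lemma adj_neq: "u \<rightarrow>\<^bsub>G\<^esub> v \<Longrightarrow> u \<noteq> v"
  using adj_not_same by blast

text \<open>The vertices come as a list because \<open>length\<close> bounds the cardinality even
  when entries coincide. Later applications need not prove their vertices distinct.\<close>

lemma small_interval_representation:
  assumes "set zs \<subseteq> verts G" "length zs \<le> 10"
  shows "\<exists>lo hi. interval_model G (set zs) lo hi"
proof -
  have "interval_graph (G \<restriction> set zs)"
  proof (rule ccontr)
    assume "\<not> interval_graph (G \<restriction> set zs)"
    then obtain Y where Y: "Y \<subseteq> set zs" "minimal_forbidden_set G Y"
      using minimal_forbidden_subset assms(1) by blast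
    moreover have "card Y \<le> 10"
      using card_mono[OF _ Y(1)] card_length[of zs] assms(2) by simp
    ultimately show False using prereduced by (auto simp: prereduced_def)
  qed
  then obtain lo hi :: "'a \<Rightarrow> real" where
    le: "\<forall>v \<in> set zs. lo v \<le> hi v" and
    adj: "\<forall>u \<in> set zs. \<forall>v \<in> set zs. u \<noteq> v \<longrightarrow>
        (u \<rightarrow>\<^bsub>G \<restriction> set zs\<^esub> v \<longleftrightarrow> {lo u..hi u} \<inter> {lo v..hi v} \<noteq> {})"
    unfolding interval_graph_def induce_subgraph_verts by blast
  have "u \<rightarrow>\<^bsub>G\<^esub> v \<longleftrightarrow> lo u \<le> hi v \<and> lo v \<le> hi u" if "u \<in> set zs" "v \<in> set zs" "u \<noteq> v" for u v
  proof -
    have "u \<rightarrow>\<^bsub>G\<^esub> v \<longleftrightarrow> {lo u..hi u} \<inter> {lo v..hi v} \<noteq> {}"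
      using adj that adj_induce_subgraph_iff by metis
    also have "\<dots> \<longleftrightarrow> lo u \<le> hi v \<and> lo v \<le> hi u"
      using le that by (auto simp: Int_atLeastAtMost)
    finally show ?thesis .
  qed
  with le show ?thesis unfolding interval_model_def by blast
qed

text \<open>A non-edge puts its two intervals in a strict order. Every choice of these orders
  contradicts the overlaps along the cycle.\<close>

lemma no_hole4:
  assumes "a \<rightarrow>\<^bsub>G\<^esub> b" "b \<rightarrow>\<^bsub>G\<^esub> c" "c \<rightarrow>\<^bsub>G\<^esub> d" "d \<rightarrow>\<^bsub>G\<^esub> a" "a \<noteq> c" "b \<noteq> d"
  shows "a \<rightarrow>\<^bsub>G\<^esub> c \<or> b \<rightarrow>\<^bsub>G\<^esub> d"
proof (rule ccontr)
  assume neg: "\<not> ?thesis"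
  have vs: "set [a,b,c,d] \<subseteq> verts G"
    using assms(1-4)[THEN adj_in_verts(1)] assms(1-4)[THEN adj_in_verts(2)] by simp
  have "\<exists>lo hi. interval_model G (set [a,b,c,d]) lo hi"
    by (rule small_interval_representation[OF vs]) simp
  then obtain lo hi where model: "interval_model G (set [a,b,c,d]) lo hi" by blast
  note adjD = interval_model_adj[OF model] and not_adjD = interval_model_not_adj[OF model]
  have adj: "lo a \<le> hi b \<and> lo b \<le> hi a" "lo b \<le> hi c \<and> lo c \<le> hi b"
    "lo c \<le> hi d \<and> lo d \<le> hi c" "lo d \<le> hi a \<and> lo a \<le> hi d"
    by (intro adjD; use assms(1-4) assms(1-4)[THEN adj_neq] in simp)+
  have non: "hi a < lo c \<or> hi c < lo a" "hi b < lo d \<or> hi d < lo b"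
    by (intro not_adjD; use assms(5,6) neg in simp)+
  from non adj show False by - (elim conjE disjE, linarith+)
qed

lemma no_hole5:
  assumes "a \<rightarrow>\<^bsub>G\<^esub> b" "b \<rightarrow>\<^bsub>G\<^esub> c" "c \<rightarrow>\<^bsub>G\<^esub> d" "d \<rightarrow>\<^bsub>G\<^esub> e" "e \<rightarrow>\<^bsub>G\<^esub> a"
    and "\<not> a \<rightarrow>\<^bsub>G\<^esub> c" "\<not> a \<rightarrow>\<^bsub>G\<^esub> d" "\<not> b \<rightarrow>\<^bsub>G\<^esub> d" "\<not> b \<rightarrow>\<^bsub>G\<^esub> e" "\<not> c \<rightarrow>\<^bsub>G\<^esub> e"
  shows False
proof -
  have vs: "set [a,b,c,d,e] \<subseteq> verts G"
    using assms(1-4)[THEN adj_in_verts(1)] assms(1-4)[THEN adj_in_verts(2)] by simp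
  have "\<exists>lo hi. interval_model G (set [a,b,c,d,e]) lo hi"
    by (rule small_interval_representation[OF vs]) simp
  then obtain lo hi where model: "interval_model G (set [a,b,c,d,e]) lo hi" by blast
  note adjD = interval_model_adj[OF model] and not_adjD = interval_model_not_adj[OF model]
  \<comment> \<open>Identifying two such vertices would turn an edge of the cycle into an excluded
    chord: \<open>a = c\<close> makes the edge \<open>c d\<close> the chord
    \<open>a d\<close>.\<close>
  have neq: "a \<noteq> c" "a \<noteq> d" "b \<noteq> d" "b \<noteq> e" "c \<noteq> e"
    using assms assms(1-5)[THEN adj_symD] by blast+
  have adj: "lo a \<le> hi b \<and> lo b \<le> hi a" "lo b \<le> hi c \<and> lo c \<le> hi b"
    "lo c \<le> hi d \<and> lo d \<le> hi c" "lo d \<le> hi e \<and> lo e \<le> hi d"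
    "lo e \<le> hi a \<and> lo a \<le> hi e"
    by (intro adjD; use assms(1-5) assms(1-5)[THEN adj_neq] in simp)+
  have non: "hi a < lo c \<or> hi c < lo a" "hi a < lo d \<or> hi d < lo a"
    "hi b < lo d \<or> hi d < lo b" "hi b < lo e \<or> hi e < lo b"
    "hi c < lo e \<or> hi e < lo c"
    by (intro not_adjD; use assms(6-10) neq in simp)+
  from non adj show False by - (elim conjE disjE, linarith+)
qed

text \<open>Of three pairwise disjoint intervals one lies between the other two, but the walk that
  avoids it joins these two and stays on one side.\<close>

lemma no_asteroidal_triple:
  assumes vs: "set zs \<subseteq> verts G" "length zs \<le> 10"
    and "set p \<subseteq> set zs" "set q \<subseteq> set zs" "set r \<subseteq> set zs"
    and "avoiding_walk G w p u v" "avoiding_walk G u q v w" "avoiding_walk G v r w u"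
  shows False
proof -
  obtain lo hi where model: "interval_model G (set zs) lo hi"
    using small_interval_representation[OF vs] by blast
  note le = interval_model_le[OF model] and adjD = interval_model_adj[OF model]
    and not_adjD = interval_model_not_adj[OF model]
  have side: "hi x < lo z \<longleftrightarrow> hi y < lo z"
    if walk: "avoiding_walk G z t x y" and sub: "z \<in> set zs" "set t \<subseteq> set zs" for z t x y
  proof -
    have "hi (hd t) < lo z \<longleftrightarrow> hi (last t) < lo z"
    proof (rule successively_same_side)
      show "successively (dominates G) t" "t \<noteq> []" using walk by (auto simp: avoiding_walk_def)
      show "lo y \<le> hi y' \<and> lo y' \<le> hi y" if "y \<in> set t" "y' \<in> set t" "y \<rightarrow>\<^bsub>G\<^esub> y'" for y y'
        using adjD[of y y'] adj_neq[of y y'] that sub(2) by blast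
      show "lo y \<le> hi y \<and> (hi y < lo z \<or> hi z < lo y)" if "y \<in> set t" for y
      proof -
        have "y \<in> set zs" "y \<noteq> z" "\<not> y \<rightarrow>\<^bsub>G\<^esub> z"
          using that sub(2) walk
          by (auto simp: avoiding_walk_def)
        then show ?thesis using not_adjD[of y z] le[of y] sub(1) by auto
      qed
      show "lo z \<le> hi z" using le sub by simp
    qed
    then show ?thesis using walk by (auto simp: avoiding_walk_def)
  qed
  have ends: "x \<in> set t" "y \<in> set t" if "avoiding_walk G z t x y" for z t x y
    using that by (auto simp: avoiding_walk_def)
  have mem: "u \<in> set zs" "v \<in> set zs" "w \<in> set zs"
    using assms ends by blast+
  \<comment> \<open>The ends of a walk avoid the third vertex as well. This makes \<open>u\<close>,
    \<open>v\<close>, \<open>w\<close> distinct and pairwise non-adjacent.\<close>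
  have sep: "x \<noteq> z \<and> \<not> x \<rightarrow>\<^bsub>G\<^esub> z" "y \<noteq> z \<and> \<not> y \<rightarrow>\<^bsub>G\<^esub> z" if "avoiding_walk G z t x y" for z t x y
    using that ends[OF that] by (auto simp: avoiding_walk_def)
  have "hi u < lo v \<or> hi v < lo u" "hi v < lo w \<or> hi w < lo v" "hi w < lo u \<or> hi u < lo w"
    using not_adjD[OF mem(1,2)] not_adjD[OF mem(2,3)] not_adjD[OF mem(3,1)]
      sep(1)[OF assms(7)] sep(1)[OF assms(8)] sep(1)[OF assms(6)]
      sep(2)[OF assms(6)] sep(2)[OF assms(7)] sep(2)[OF assms(8)] adj_symD by metis+
  moreover have "hi u < lo w \<longleftrightarrow> hi v < lo w" "hi v < lo u \<longleftrightarrow> hi w < lo u"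
    "hi w < lo v \<longleftrightarrow> hi u < lo v"
    using side[OF assms(6)] side[OF assms(7)] side[OF assms(8)] mem assms(3-5) by blast+
  ultimately show False
    using le[OF mem(1)] le[OF mem(2)] le[OF mem(3)] by auto
qed

end

section \<open>A common frame for both kinds of AWs\<close>

text \<open>
  A common weakening of both kinds of AWs: \<open>b 0, \<dots>, b n\<close> is the path from \<open>l\<close> to \<open>r\<close>, so that the
  base is \<open>b ` {1..<n}\<close>. For a \<open>\<dagger>\<close>-AW the two centres coincide.
\<close>

locale AW_frame = prereduced_graph G for G :: "('a,'b) pre_digraph" (structure) +
  fixes s :: 'a and b :: "nat \<Rightarrow> 'a" and n :: nat and cl cr :: 'a
  assumes n_ge: "3 \<le> n"
    and b_inj: "inj_on b {0..n}"
    and b_adj: "\<And>i j. i \<le> n \<Longrightarrow> j \<le> n \<Longrightarrow> b i \<rightarrow>\<^bsub>G\<^esub> b j \<longleftrightarrow> i = Suc j \<or> j = Suc i"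
    and s_b: "\<And>i. i \<le> n \<Longrightarrow> s \<noteq> b i \<and> \<not> s \<rightarrow>\<^bsub>G\<^esub> b i"
    and centre_s: "cl \<rightarrow>\<^bsub>G\<^esub> s" "cr \<rightarrow>\<^bsub>G\<^esub> s"
    and centre_base: "\<And>i. 0 < i \<Longrightarrow> i < n \<Longrightarrow> cl \<rightarrow>\<^bsub>G\<^esub> b i"
      "\<And>i. 0 < i \<Longrightarrow> i < n \<Longrightarrow> cr \<rightarrow>\<^bsub>G\<^esub> b i"
    and centre_ends: "\<not> cl \<rightarrow>\<^bsub>G\<^esub> b n" "\<not> cr \<rightarrow>\<^bsub>G\<^esub> b 0"
begin

text \<open>Reading the path from \<open>r\<close> to \<open>l\<close> exchanges the centres. An
  exclusion proved at one end of the path thus holds at the other.\<close>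

lemma reversed_frame: "AW_frame G s (\<lambda>i. b (n - i)) n cr cl"
proof unfold_locales
  show "inj_on (\<lambda>i. b (n - i)) {0..n}"
  proof (rule inj_onI)
    fix i j assume "i \<in> {0..n}" "j \<in> {0..n}" "b (n - i) = b (n - j)"
    then show "i = j" using inj_onD[OF b_inj, of "n - i" "n - j"] by auto
  qed
qed (use n_ge b_adj s_b centre_s centre_base centre_ends in auto)

lemma b_eq_iff: "i \<le> n \<Longrightarrow> j \<le> n \<Longrightarrow> b i = b j \<longleftrightarrow> i = j"
  using b_inj by (auto simp: inj_on_def)

lemma b_in_verts:
  assumes "i \<le> n" shows "b i \<in> verts G"
proof (cases i)
  case 0
  then have "b i \<rightarrow>\<^bsub>G\<^esub> b 1" using b_adj[of 0 1] n_ge by simp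
  then show ?thesis by (rule adj_in_verts)
next
  case (Suc j)
  then have "b j \<rightarrow>\<^bsub>G\<^esub> b i" using b_adj[of j i] assms by simp
  then show ?thesis by (rule adj_in_verts)
qed

lemma s_b': "i \<le> n \<Longrightarrow> b i \<noteq> s \<and> \<not> b i \<rightarrow>\<^bsub>G\<^esub> s"
  using s_b adj_sym by metis

lemma frame_verts: "s \<in> verts G" "cl \<in> verts G" "cr \<in> verts G"
  using centre_s adj_in_verts by blast+

lemma centre_sym: "s \<rightarrow>\<^bsub>G\<^esub> cl" "s \<rightarrow>\<^bsub>G\<^esub> cr" "\<And>i. 0 < i \<Longrightarrow> i < n \<Longrightarrow> b i \<rightarrow>\<^bsub>G\<^esub> cl"
  "\<And>i. 0 < i \<Longrightarrow> i < n \<Longrightarrow> b i \<rightarrow>\<^bsub>G\<^esub> cr" "\<not> b n \<rightarrow>\<^bsub>G\<^esub> cl" "\<not> b 0 \<rightarrow>\<^bsub>G\<^esub> cr"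
  using centre_s centre_base centre_ends adj_sym by metis+

lemma centre_not_b: "i \<le> n \<Longrightarrow> cl \<noteq> b i" "i \<le> n \<Longrightarrow> cr \<noteq> b i"
  using centre_s s_b' by blast+

lemmas frame_simps = b_adj b_eq_iff b_in_verts s_b s_b' frame_verts centre_s centre_base centre_ends
  centre_sym centre_not_b centre_not_b[symmetric]

section \<open>Two non-adjacent neighbours \<open>x\<close>, \<open>m\<close> of \<open>s\<close>:
  excluded positions of \<open>x\<close> along the path\<close>

context
  fixes x m :: 'a
  assumes sx: "s \<rightarrow>\<^bsub>G\<^esub> x" and sm: "s \<rightarrow>\<^bsub>G\<^esub> m" and m_neq_x: "m \<noteq> x" and mx: "\<not> m \<rightarrow>\<^bsub>G\<^esub> x"
begin

lemma xm_sym: "x \<rightarrow>\<^bsub>G\<^esub> s" "m \<rightarrow>\<^bsub>G\<^esub> s" "\<not> x \<rightarrow>\<^bsub>G\<^esub> m" "x \<noteq> m"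
  using sx sm m_neq_x mx adj_sym by blast+

lemma xm_verts: "x \<in> verts G" "m \<in> verts G"
  using sx sm adj_in_verts by blast+

lemma xm_not_b: "i \<le> n \<Longrightarrow> x \<noteq> b i" "i \<le> n \<Longrightarrow> m \<noteq> b i"
  using sx sm s_b by blast+

text \<open>Otherwise \<open>s\<close>, \<open>x\<close>, \<open>b j\<close>, \<open>m\<close> form
  a hole of length four.\<close>

lemma m_avoids_nbr:
  assumes "j \<le> n" "x \<rightarrow>\<^bsub>G\<^esub> b j"
  shows "\<not> m \<rightarrow>\<^bsub>G\<^esub> b j" "\<not> b j \<rightarrow>\<^bsub>G\<^esub> m"
proof -
  show "\<not> m \<rightarrow>\<^bsub>G\<^esub> b j"
    using no_hole4[of s x "b j" m] sx sm mx m_neq_x assms s_b[of j] adj_sym by metis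
  then show "\<not> b j \<rightarrow>\<^bsub>G\<^esub> m" using adj_sym by blast
qed

text \<open>Otherwise \<open>s\<close>, \<open>x\<close>, \<open>b j\<close>, \<open>b k\<close>,
  \<open>m\<close> form a hole of length five.\<close>

lemma m_avoids_boundary:
  assumes "j \<le> n" "k \<le> n" "x \<rightarrow>\<^bsub>G\<^esub> b j" "\<not> x \<rightarrow>\<^bsub>G\<^esub> b k" "b j \<rightarrow>\<^bsub>G\<^esub> b k"
  shows "\<not> m \<rightarrow>\<^bsub>G\<^esub> b k" "\<not> b k \<rightarrow>\<^bsub>G\<^esub> m"
proof -
  show "\<not> m \<rightarrow>\<^bsub>G\<^esub> b k"
    using no_hole5[of s x "b j" "b k" m] sx xm_sym assms s_b[of j] s_b[of k] m_avoids_nbr[of j] adj_sym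
    by metis
  then show "\<not> b k \<rightarrow>\<^bsub>G\<^esub> m" using adj_sym by blast
qed

lemmas xm_simps = sx sm m_neq_x mx xm_sym xm_verts xm_not_b xm_not_b[symmetric]

text \<open>The asteroidal triple is \<open>m\<close>, \<open>b p'\<close>, \<open>b q'\<close>. The
  two preceding lemmas keep \<open>m\<close> away from all four path vertices.\<close>

lemma far_boundaries:
  assumes "x \<rightarrow>\<^bsub>G\<^esub> b p" "\<not> x \<rightarrow>\<^bsub>G\<^esub> b p'" "b p \<rightarrow>\<^bsub>G\<^esub> b p'"
    and "x \<rightarrow>\<^bsub>G\<^esub> b q" "\<not> x \<rightarrow>\<^bsub>G\<^esub> b q'" "b q \<rightarrow>\<^bsub>G\<^esub> b q'"
    and "p \<le> n" "p' \<le> n" "q \<le> n" "q' \<le> n"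
    and "\<not> b p' \<rightarrow>\<^bsub>G\<^esub> b q'" "\<not> b p \<rightarrow>\<^bsub>G\<^esub> b q'" "\<not> b q \<rightarrow>\<^bsub>G\<^esub> b p'" "p' \<noteq> q'" "p \<noteq> q'" "q \<noteq> p'"
  shows False
proof (rule no_asteroidal_triple)
  have sym: "b p' \<rightarrow>\<^bsub>G\<^esub> b p" "b q' \<rightarrow>\<^bsub>G\<^esub> b q" "b p \<rightarrow>\<^bsub>G\<^esub> x" "b q \<rightarrow>\<^bsub>G\<^esub> x"
    "\<not> b q' \<rightarrow>\<^bsub>G\<^esub> b p'" "\<not> b q' \<rightarrow>\<^bsub>G\<^esub> b p"
    "\<not> b p' \<rightarrow>\<^bsub>G\<^esub> x" "\<not> b q' \<rightarrow>\<^bsub>G\<^esub> x" "\<not> b p' \<rightarrow>\<^bsub>G\<^esub> b q" "q' \<noteq> p'"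
    using assms adj_sym by blast+
  note m = m_avoids_nbr[of p] m_avoids_nbr[of q] m_avoids_boundary[of p p'] m_avoids_boundary[of q q']
  note [simp] = assms sym m xm_simps s_b s_b' b_in_verts b_eq_iff frame_verts
  show "set [m, s, x, b p, b p', b q, b q'] \<subseteq> verts G" by simp
  show "avoiding_walk G (b q') [m, s, x, b p, b p'] m (b p')" by (simp add: avoiding_walk_def)
  show "avoiding_walk G m [b p', b p, x, b q, b q'] (b p') (b q')" by (simp add: avoiding_walk_def)
  show "avoiding_walk G (b p') [b q', b q, x, s, m] (b q') m" by (simp add: avoiding_walk_def)
qed simp_all

text \<open>Two distinct extreme neighbours are needed: if they coincided, that vertex would be
  adjacent to both outer vertices, and no walk through it could avoid either of them.\<close>

lemma not_inner_segment:
  assumes "Suc p < q" "q < n" "x \<rightarrow>\<^bsub>G\<^esub> b (Suc p)" "x \<rightarrow>\<^bsub>G\<^esub> b q" "\<not> x \<rightarrow>\<^bsub>G\<^esub> b p" "\<not> x \<rightarrow>\<^bsub>G\<^esub> b (Suc q)"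
  shows False
  using far_boundaries[of "Suc p" p q "Suc q"] assms by (simp add: b_adj)

text \<open>Three legs of length two leave the only neighbour \<open>b (i + 2)\<close> of
  \<open>x\<close>, ending in \<open>b i\<close>, \<open>b (i + 4)\<close> and, through
  \<open>x\<close>, in \<open>s\<close>. Their ends are an asteroidal triple.\<close>

lemma not_single_inner:
  assumes "i + 4 \<le> n" "x \<rightarrow>\<^bsub>G\<^esub> b (Suc (Suc i))"
    and only: "\<And>j. j \<le> n \<Longrightarrow> j \<noteq> Suc (Suc i) \<Longrightarrow> \<not> x \<rightarrow>\<^bsub>G\<^esub> b j"
  shows False
proof (rule no_asteroidal_triple)
  let ?b = "\<lambda>k. b ((Suc ^^ k) i)"
  have sym: "b (Suc (Suc i)) \<rightarrow>\<^bsub>G\<^esub> x" using assms adj_sym by blast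
  have only': "\<not> b j \<rightarrow>\<^bsub>G\<^esub> x" if "j \<le> n" "j \<noteq> Suc (Suc i)" for j using only that adj_sym by blast
  have [simp]: "i \<le> n" "Suc i \<le> n" "Suc (Suc i) \<le> n" "Suc (Suc (Suc i)) \<le> n"
    "Suc (Suc (Suc (Suc i))) \<le> n"
    using assms by auto
  note [simp] = assms(2) sym only only' xm_simps frame_simps avoiding_walk_def numeral_eq_Suc
  show "set [s, x, ?b 0, ?b 1, ?b 2, ?b 3, ?b 4] \<subseteq> verts G" by simp
  show "avoiding_walk G (?b 4) [s, x, ?b 2, ?b 1, ?b 0] s (?b 0)" by simp
  show "avoiding_walk G s [?b 0, ?b 1, ?b 2, ?b 3, ?b 4] (?b 0) (?b 4)" by simp
  show "avoiding_walk G (?b 0) [?b 4, ?b 3, ?b 2, x, s] (?b 4) s" by simp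
qed simp_all

text \<open>Only one path vertex precedes \<open>b 1\<close>, so the triple is \<open>s\<close>,
  \<open>b 0\<close>, \<open>b 3\<close>. A walk from \<open>b 3\<close> to \<open>s\<close> through
  \<open>b 1\<close> would touch the neighbourhood of \<open>b 0\<close>, and \<open>cr\<close>
  provides the detour.\<close>

lemma not_single_first:
  assumes "x \<rightarrow>\<^bsub>G\<^esub> b 1" and only: "\<And>j. j \<le> n \<Longrightarrow> j \<noteq> 1 \<Longrightarrow> \<not> x \<rightarrow>\<^bsub>G\<^esub> b j"
  shows False
proof (rule no_asteroidal_triple)
  have sym: "b (Suc 0) \<rightarrow>\<^bsub>G\<^esub> x" "x \<rightarrow>\<^bsub>G\<^esub> b (Suc 0)" using assms adj_sym by auto
  have only': "\<not> b j \<rightarrow>\<^bsub>G\<^esub> x" if "j \<le> n" "j \<noteq> 1" for j using only that adj_sym by blast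
  have [simp]: "Suc 0 \<le> n" "Suc (Suc 0) \<le> n" "Suc 0 < n" "Suc (Suc 0) < n" "Suc (Suc (Suc 0)) \<le> n"
    using n_ge by auto
  note [simp] = sym only only' xm_simps frame_simps avoiding_walk_def numeral_eq_Suc
  show "set [s, x, cr, b 0, b 1, b 2, b 3] \<subseteq> verts G" by simp
  show "avoiding_walk G (b 3) [s, x, b 1, b 0] s (b 0)" by simp
  show "avoiding_walk G s [b 0, b 1, b 2, b 3] (b 0) (b 3)" by simp
  show "avoiding_walk G (b 0) [b 3, b 2, cr, s] (b 3) s" by simp
qed simp_all

text \<open>The triple is \<open>m\<close>, \<open>b 0\<close>, \<open>b (Suc q)\<close>. As
  \<open>x\<close> sees \<open>b 0\<close>, the walk avoiding \<open>b 0\<close> passes through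
  \<open>cr\<close> instead.\<close>

lemma not_initial_segment:
  assumes "1 \<le> q" "q < n" "x \<rightarrow>\<^bsub>G\<^esub> b 0" "x \<rightarrow>\<^bsub>G\<^esub> b q" "\<not> x \<rightarrow>\<^bsub>G\<^esub> b (Suc q)"
  shows False
proof (rule no_asteroidal_triple)
  have sym: "b 0 \<rightarrow>\<^bsub>G\<^esub> x" "b q \<rightarrow>\<^bsub>G\<^esub> x" "\<not> b (Suc q) \<rightarrow>\<^bsub>G\<^esub> x" using assms adj_sym by auto
  have [simp]: "q \<le> n" "Suc q \<le> n" "0 < q" using assms by auto
  have [simp]: "q = 1 \<Longrightarrow> Suc (Suc 0) < n" "q = 1 \<Longrightarrow> Suc (Suc 0) \<le> n" using n_ge by auto
  note m = m_avoids_nbr[of 0] m_avoids_nbr[of q] m_avoids_boundary[of q "Suc q"]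
  note [simp] = assms sym m xm_simps frame_simps avoiding_walk_def
  \<comment> \<open>For \<open>q = 1\<close> the vertex \<open>b q\<close> is next to
    \<open>b 0\<close> and must be skipped; \<open>b 2\<close> is then in the base and sees
    \<open>cr\<close>. For larger \<open>q\<close> the vertex \<open>b (Suc q)\<close> may be the
    end \<open>b n\<close>, whose adjacency to \<open>cr\<close> is left open, so \<open>b q\<close>
    mediates.\<close>
  let ?r = "if q = 1 then [b (Suc q), cr, s, m] else [b (Suc q), b q, cr, s, m]"
  show "set [b 0, m, b (Suc q), x, s, cr, b q] \<subseteq> verts G" by simp
  show "avoiding_walk G (b (Suc q)) [m, s, x, b 0] m (b 0)" by simp
  show "avoiding_walk G m [b 0, x, b q, b (Suc q)] (b 0) (b (Suc q))" by simp
  show "avoiding_walk G (b 0) ?r (b (Suc q)) m" by auto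
qed auto

text \<open>The triple is \<open>m\<close>, \<open>b 0\<close>, \<open>b n\<close>. Each end is
  reached from \<open>s\<close> through the centre that misses the other end, and through a base
  vertex, since the frame does not say whether a centre sees its own end.\<close>

lemma not_full:
  assumes "x \<rightarrow>\<^bsub>G\<^esub> b 0" "x \<rightarrow>\<^bsub>G\<^esub> b n"
  shows False
proof (rule no_asteroidal_triple)
  have sym: "b 0 \<rightarrow>\<^bsub>G\<^esub> x" "b n \<rightarrow>\<^bsub>G\<^esub> x" using assms adj_sym by auto
  have [simp]: "Suc 0 \<le> n" "n - Suc 0 \<le> n" "0 < n" "Suc 0 < n" "0 < n - Suc 0" "n - Suc 0 < n"
    "n \<noteq> Suc 0" "n \<noteq> Suc (Suc 0)"
    using n_ge by auto
  note m = m_avoids_nbr[of 0] m_avoids_nbr[of n]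
  note [simp] = assms sym m xm_simps frame_simps avoiding_walk_def
  show "set [m, s, x, cl, cr, b 0, b 1, b (n - 1), b n] \<subseteq> verts G" by simp
  show "avoiding_walk G (b n) [m, s, cl, b 1, b 0] m (b 0)" using n_ge by auto
  show "avoiding_walk G m [b 0, x, b n] (b 0) (b n)" by simp
  show "avoiding_walk G (b 0) [b n, b (n - 1), cr, s, m] (b n) m" using n_ge by auto
qed simp_all

end

text \<open>The first and the last neighbour of \<open>x\<close> on the path, compared with each
  other and with the ends, select one of the exclusions above.\<close>

lemma nbr_of_base_absorbs_nbrs:
  assumes "s \<rightarrow>\<^bsub>G\<^esub> x" "x \<rightarrow>\<^bsub>G\<^esub> b i" "0 < i" "i < n" "s \<rightarrow>\<^bsub>G\<^esub> m" "m \<noteq> x"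
  shows "m \<rightarrow>\<^bsub>G\<^esub> x"
proof (rule ccontr)
  assume "\<not> m \<rightarrow>\<^bsub>G\<^esub> x"
  note xm = \<open>s \<rightarrow>\<^bsub>G\<^esub> x\<close> \<open>s \<rightarrow>\<^bsub>G\<^esub> m\<close> \<open>m \<noteq> x\<close> this
  interpret rev: AW_frame G s "\<lambda>i. b (n - i)" n cr cl by (rule reversed_frame)
  \<comment> \<open>The ends \<open>b 0\<close> and \<open>b n\<close> count here too, although only
    \<open>b i\<close> is known to be in the base.\<close>
  define X where "X = {j. j \<le> n \<and> x \<rightarrow>\<^bsub>G\<^esub> b j}"
  define p q where "p = Min X" and "q = Max X"
  have "finite X" by (simp add: X_def)
  have "i \<in> X" using assms by (simp add: X_def)
  then have pq: "p \<in> X" "q \<in> X" "p \<le> i" "i \<le> q"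
    using \<open>finite X\<close> by (auto simp: p_def q_def intro: Min_in Max_in)
  then have xpq: "x \<rightarrow>\<^bsub>G\<^esub> b p" "x \<rightarrow>\<^bsub>G\<^esub> b q" "q \<le> n" by (auto simp: X_def)
  have outside: "\<not> x \<rightarrow>\<^bsub>G\<^esub> b j" if "j \<le> n" "j < p \<or> q < j" for j
  proof
    assume "x \<rightarrow>\<^bsub>G\<^esub> b j"
    then have "j \<in> X" using that by (simp add: X_def)
    then have "p \<le> j" "j \<le> q" using \<open>finite X\<close> by (auto simp: p_def q_def)
    then show False using that by simp
  qed
  show False
  proof (cases "p = q")
    case True
    then have "p = i" "q = i" using pq by auto
    then have only: "\<not> x \<rightarrow>\<^bsub>G\<^esub> b j" if "j \<le> n" "j \<noteq> i" for j
      using outside[OF that(1)] that(2) \<open>p = i\<close> \<open>q = i\<close> by (metis nat_neq_iff)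
    \<comment> \<open>In the last case the path extends two steps on both sides of
      \<open>b i\<close>.\<close>
    consider "i = 1" | "i = n - 1" | "2 \<le> i" "i + 2 \<le> n" using assms by linarith
    then show False
    proof cases
      case 1
      then show False using not_single_first[OF xm] assms only by simp
    next
      case 2
      show False
      proof (rule rev.not_single_first[OF xm])
        show "x \<rightarrow>\<^bsub>G\<^esub> b (n - 1)" using 2 assms by simp
        show "\<not> x \<rightarrow>\<^bsub>G\<^esub> b (n - j)" if "j \<le> n" "j \<noteq> 1" for j
          using only[of "n - j"] that 2 n_ge by simp
      qed
    next
      case 3
      then obtain k where "i = Suc (Suc k)"
        by (metis Suc_le_D numeral_2_eq_2 Suc_le_mono)
      then show False using not_single_inner[OF xm, of k] 3 assms only by simp
    qed
  next
    case False
    then have "p < q" using pq by simp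
    consider "p = 0" "q = n" | "p = 0" "q < n" | "0 < p" "q = n" | "0 < p" "q < n"
      using xpq by linarith
    then show False
    proof cases
      case 1
      then show False using not_full[OF xm] xpq by simp
    next
      case 2
      then show False
        using not_initial_segment[OF xm, of q] xpq \<open>p < q\<close> outside[of "Suc q"] by simp
    next
      case 3
      \<comment> \<open>On the reversed path \<open>b p\<close> has index \<open>n - p\<close>, and
        the vertex after it is \<open>b (p - 1)\<close>.\<close>
      have "n - (n - p) = p" "n - Suc (n - p) = p - 1" "1 \<le> n - p" "n - p < n" "p - 1 \<le> n" using \<open>p < q\<close> 3 by auto
      then show False
        using rev.not_initial_segment[OF xm, of "n - p"] 3 xpq \<open>p < q\<close> outside[of "p - 1"] by simp
    next
      case 4
      then obtain k where "p = Suc k" by (cases p) auto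
      then show False
        using not_inner_segment[OF xm, of k q] xpq \<open>p < q\<close> 4 outside[of k] outside[of "Suc q"]
        by simp
    qed
  qed
qed

section \<open>The set \<open>C\<close> and the change of the shallow terminal\<close>

definition common_nbrs :: "'a set" where
  "common_nbrs = neighbourhood G {s} \<inter> neighbourhood G (b ` {1..<n})"

lemma common_nbrs_iff: "x \<in> common_nbrs \<longleftrightarrow> s \<rightarrow>\<^bsub>G\<^esub> x \<and> (\<exists>i. 0 < i \<and> i < n \<and> x \<rightarrow>\<^bsub>G\<^esub> b i)"
proof
  assume "x \<in> common_nbrs"
  then have x: "x \<in> neighbourhood G {s}" "x \<in> neighbourhood G (b ` {1..<n})"
    by (simp_all add: common_nbrs_def)
  then have "s \<rightarrow>\<^bsub>G\<^esub> x" by (auto simp: neighbourhood_def closed_neighbourhood_def)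
  moreover have "\<exists>i. 0 < i \<and> i < n \<and> b i \<rightarrow>\<^bsub>G\<^esub> x"
  proof -
    obtain i where "i \<in> {1..<n}" "x \<in> closed_neighbourhood G (b i)" "x \<noteq> b i"
      using x(2) unfolding neighbourhood_def by blast
    then show ?thesis by (intro exI[of _ i]) (simp add: closed_neighbourhood_def)
  qed
  ultimately show "s \<rightarrow>\<^bsub>G\<^esub> x \<and> (\<exists>i. 0 < i \<and> i < n \<and> x \<rightarrow>\<^bsub>G\<^esub> b i)" using adj_symD by blast
next
  assume "s \<rightarrow>\<^bsub>G\<^esub> x \<and> (\<exists>i. 0 < i \<and> i < n \<and> x \<rightarrow>\<^bsub>G\<^esub> b i)"
  then obtain i where x: "s \<rightarrow>\<^bsub>G\<^esub> x" "0 < i" "i < n" "b i \<rightarrow>\<^bsub>G\<^esub> x" using adj_symD by blast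
  then have "x \<in> neighbourhood G {s}"
    using adj_neq[OF x(1)] by (simp add: neighbourhood_def closed_neighbourhood_def)
  \<comment> \<open>\<open>neighbourhood\<close> removes the base itself, which contains no
    neighbour of \<open>s\<close>.\<close>
  moreover have "x \<notin> b ` {1..<n}" using x(1) s_b by auto
  then have "x \<in> neighbourhood G (b ` {1..<n})"
    using x(2-4) by (force simp: neighbourhood_def closed_neighbourhood_def)
  ultimately show "x \<in> common_nbrs" by (simp add: common_nbrs_def)
qed

lemma common_nbrs_absorb:
  assumes "x \<in> common_nbrs" "s \<rightarrow>\<^bsub>G\<^esub> m" "m \<noteq> x"
  shows "m \<rightarrow>\<^bsub>G\<^esub> x"
  using assms nbr_of_base_absorbs_nbrs by (auto simp: common_nbrs_iff)

lemma centres_common: "cl \<in> common_nbrs" "cr \<in> common_nbrs"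
  using centre_sym centre_base[of 1] n_ge by (auto simp: common_nbrs_iff intro!: exI[of _ 1])

end

text \<open>Outside \<open>common_nbrs\<close>, \<open>m\<close> misses the base, and it sees both
  centres by absorption. An edge from \<open>m\<close> to \<open>b 0\<close> would close the hole
  \<open>m\<close>, \<open>b 0\<close>, \<open>b 1\<close>, \<open>cr\<close>; at \<open>b n\<close>
  the centre \<open>cl\<close> takes this part.\<close>

lemma (in AW_frame) shift_terminal:
  assumes sm: "s \<rightarrow>\<^bsub>G\<^esub> m" and not_common: "m \<notin> common_nbrs"
  shows "AW_frame G m b n cl cr"
proof unfold_locales
  have m_base: "\<not> m \<rightarrow>\<^bsub>G\<^esub> b i" if "0 < i" "i < n" for i
    using assms that by (auto simp: common_nbrs_iff)
  have centres: "m \<rightarrow>\<^bsub>G\<^esub> cl" "m \<rightarrow>\<^bsub>G\<^esub> cr"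
    using common_nbrs_absorb[OF centres_common(1) sm] common_nbrs_absorb[OF centres_common(2) sm]
      centres_common not_common by auto
  have "\<not> m \<rightarrow>\<^bsub>G\<^esub> b 0"
    using no_hole4[of m "b 0" "b 1" cr] centres m_base[of 1] n_ge b_adj[of 0 1] centre_sym(4)[of 1]
      centre_sym(6) s_b[of 1] sm adj_symD by (auto simp: centre_not_b[symmetric])
  moreover have "\<not> m \<rightarrow>\<^bsub>G\<^esub> b n"
  proof -
    have "b n \<rightarrow>\<^bsub>G\<^esub> b (n - 1)" using b_adj[of n "n - 1"] n_ge by simp
    moreover have "b (n - 1) \<rightarrow>\<^bsub>G\<^esub> cl" using centre_sym(3)[of "n - 1"] n_ge by simp
    ultimately show ?thesis
      using no_hole4[of m "b n" "b (n - 1)" cl] centres m_base[of "n - 1"] n_ge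
        centre_sym(5) s_b[of "n - 1"] sm adj_symD by (auto simp: centre_not_b[symmetric])
  qed
  ultimately show "m \<noteq> b i \<and> \<not> m \<rightarrow>\<^bsub>G\<^esub> b i" if "i \<le> n" for i
    using that sm s_b[of i] m_base[of i] by (cases "i = 0 \<or> i = n") auto
  show "cl \<rightarrow>\<^bsub>G\<^esub> m" "cr \<rightarrow>\<^bsub>G\<^esub> m" using centres adj_symD by blast+
qed (use n_ge b_inj b_adj centre_base centre_ends in auto)

text \<open>Both frames share the base, and absorption applies with either terminal: common
  neighbours for \<open>m\<close> are adjacent to \<open>s\<close>, and those for \<open>s\<close>
  to \<open>m\<close>.\<close>

lemma (in AW_frame) shift_common_nbrs:
  assumes sm: "s \<rightarrow>\<^bsub>G\<^esub> m" and not_common: "m \<notin> common_nbrs"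
  shows "AW_frame.common_nbrs G m b n = common_nbrs"
proof -
  interpret m: AW_frame G m b n cl cr using assms by (rule shift_terminal)
  have s_not_common: "s \<notin> m.common_nbrs"
    using s_b by (auto simp: m.common_nbrs_iff)
  show ?thesis
  proof (intro set_eqI iffI)
    fix x assume x: "x \<in> m.common_nbrs"
    then have "s \<rightarrow>\<^bsub>G\<^esub> x" using m.common_nbrs_absorb[OF x adj_symD[OF sm]] s_not_common by auto
    with x show "x \<in> common_nbrs" by (auto simp: common_nbrs_iff m.common_nbrs_iff)
  next
    fix x assume x: "x \<in> common_nbrs"
    then have "m \<rightarrow>\<^bsub>G\<^esub> x" using common_nbrs_absorb[OF x sm] not_common by auto
    with x show "x \<in> m.common_nbrs" by (auto simp: common_nbrs_iff m.common_nbrs_iff)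
  qed
qed

section \<open>Both kinds of AWs yield frames\<close>

lemma (in prereduced_graph) dagger_frame:
  assumes W: "induced_subgraph W G" and AW: "dagger_AW W s c l B r"
  shows "\<exists>b n. AW_frame G s b n c c \<and> B = b ` {1..<n}"
proof -
  obtain d :: nat and b where d: "d \<ge> 3" and B: "B = b ` {1..d}" and inj: "inj_on b {0..d + 1}"
    and disj: "distinct [s, c]" "{s, c} \<inter> b ` {0..d + 1} = {}"
    and V: "verts W = {s, c} \<union> b ` {0..d + 1}"
    and E: "let E = {(b i, b (i + 1)) | i. i \<le> d} \<union> {(c, s)} \<union> {(c, b i) | i. i \<in> {1..d}}
      in arcs_ends W = E \<union> E\<inverse>"
    using AW unfolding dagger_AW_def by blast
  note E = E[unfolded Let_def]
  have b_in: "i \<le> Suc d \<Longrightarrow> b i \<in> verts W" for i using V by auto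
  have sc_in: "s \<in> verts W" "c \<in> verts W" using V by auto
  have b_eq: "i \<le> Suc d \<Longrightarrow> j \<le> Suc d \<Longrightarrow> b i = b j \<longleftrightarrow> i = j" for i j
    using inj by (auto simp: inj_on_def)
  have neq: "i \<le> Suc d \<Longrightarrow> b i \<noteq> s \<and> b i \<noteq> c \<and> s \<noteq> b i \<and> c \<noteq> b i" for i
    using disj(2) by auto
  have adj: "u \<rightarrow>\<^bsub>G\<^esub> v \<longleftrightarrow> (u, v) \<in> arcs_ends W" if "u \<in> verts W" "v \<in> verts W" for u v
    using induced_subgraph_adj_iff[OF W that] by simp
  have "AW_frame G s b (Suc d) c c"
  proof unfold_locales
    show "inj_on b {0..Suc d}" using inj by simp
    show "b i \<rightarrow>\<^bsub>G\<^esub> b j \<longleftrightarrow> i = Suc j \<or> j = Suc i" if "i \<le> Suc d" "j \<le> Suc d" for i j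
    proof -
      have "b i \<rightarrow>\<^bsub>G\<^esub> b j \<longleftrightarrow> (\<exists>k \<le> d. b i = b k \<and> b j = b (Suc k) \<or> b j = b k \<and> b i = b (Suc k))"
        using that by (auto simp: adj b_in E neq)
      also have "\<dots> \<longleftrightarrow> i = Suc j \<or> j = Suc i" using that by (auto simp: b_eq)
      finally show ?thesis .
    qed
    show "s \<noteq> b i \<and> \<not> s \<rightarrow>\<^bsub>G\<^esub> b i" if "i \<le> Suc d" for i
      using that disj(1) by (auto simp: adj b_in sc_in E neq)
    show "c \<rightarrow>\<^bsub>G\<^esub> s" by (simp add: adj sc_in E)
    show "c \<rightarrow>\<^bsub>G\<^esub> b i" if "0 < i" "i < Suc d" for i
      using that by (auto simp: adj b_in sc_in E)
    show "\<not> c \<rightarrow>\<^bsub>G\<^esub> b (Suc d)" "\<not> c \<rightarrow>\<^bsub>G\<^esub> b 0"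
      using disj(1) by (auto simp: adj b_in sc_in E neq b_eq)
  qed (use d in simp)
  moreover have "B = b ` {1..<Suc d}" using B by (simp add: atLeastLessThanSuc_atLeastAtMost)
  ultimately show ?thesis by blast
qed

text \<open>Here \<open>c\<^sub>1\<close> sees the end \<open>l\<close> but not \<open>r\<close>, so
  it becomes the left centre. With \<open>n = d + 1\<close>, the bound \<open>d \<ge> 2\<close> is
  exactly \<open>3 \<le> n\<close>.\<close>

lemma (in prereduced_graph) ddagger_frame:
  assumes W: "induced_subgraph W G" and AW: "ddagger_AW W s c\<^sub>1 c\<^sub>2 l B r"
  shows "\<exists>b n. AW_frame G s b n c\<^sub>1 c\<^sub>2 \<and> B = b ` {1..<n}"
proof -
  obtain d :: nat and b where d: "d \<ge> 2" and lr: "l = b 0" "r = b (d + 1)"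
    and B: "B = b ` {1..d}" and inj: "inj_on b {0..d + 1}"
    and disj: "distinct [s, c\<^sub>1, c\<^sub>2]" "{s, c\<^sub>1, c\<^sub>2} \<inter> b ` {0..d + 1} = {}"
    and V: "verts W = {s, c\<^sub>1, c\<^sub>2} \<union> b ` {0..d + 1}"
    and E: "let E = {(b i, b (i + 1)) | i. i \<le> d}
            \<union> {(c\<^sub>1, c\<^sub>2), (c\<^sub>1, s), (c\<^sub>2, s), (c\<^sub>1, l), (c\<^sub>2, r)}
            \<union> {(c, b i) | c i. c \<in> {c\<^sub>1, c\<^sub>2} \<and> i \<in> {1..d}}
      in arcs_ends W = E \<union> E\<inverse>"
    using AW unfolding ddagger_AW_def by blast
  note E = E[unfolded Let_def]
  have b_in: "i \<le> Suc d \<Longrightarrow> b i \<in> verts W" for i using V by auto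
  have sc_in: "s \<in> verts W" "c\<^sub>1 \<in> verts W" "c\<^sub>2 \<in> verts W" using V by auto
  have b_eq: "i \<le> Suc d \<Longrightarrow> j \<le> Suc d \<Longrightarrow> b i = b j \<longleftrightarrow> i = j" for i j
    using inj by (auto simp: inj_on_def)
  have neq: "i \<le> Suc d \<Longrightarrow> b i \<noteq> s \<and> b i \<noteq> c\<^sub>1 \<and> b i \<noteq> c\<^sub>2 \<and>
      s \<noteq> b i \<and> c\<^sub>1 \<noteq> b i \<and> c\<^sub>2 \<noteq> b i" for i
    using disj(2) by auto
  have adj: "u \<rightarrow>\<^bsub>G\<^esub> v \<longleftrightarrow> (u, v) \<in> arcs_ends W" if "u \<in> verts W" "v \<in> verts W" for u v
    using induced_subgraph_adj_iff[OF W that] by simp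
  have "AW_frame G s b (Suc d) c\<^sub>1 c\<^sub>2"
  proof unfold_locales
    show "inj_on b {0..Suc d}" using inj by simp
    show "b i \<rightarrow>\<^bsub>G\<^esub> b j \<longleftrightarrow> i = Suc j \<or> j = Suc i" if "i \<le> Suc d" "j \<le> Suc d" for i j
    proof -
      have "b i \<rightarrow>\<^bsub>G\<^esub> b j \<longleftrightarrow> (\<exists>k \<le> d. b i = b k \<and> b j = b (Suc k) \<or> b j = b k \<and> b i = b (Suc k))"
        using that by (auto simp: adj b_in E neq)
      also have "\<dots> \<longleftrightarrow> i = Suc j \<or> j = Suc i" using that by (auto simp: b_eq)
      finally show ?thesis .
    qed
    show "s \<noteq> b i \<and> \<not> s \<rightarrow>\<^bsub>G\<^esub> b i" if "i \<le> Suc d" for i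
      using that disj(1) by (auto simp: adj b_in sc_in E neq lr)
    show "c\<^sub>1 \<rightarrow>\<^bsub>G\<^esub> s" "c\<^sub>2 \<rightarrow>\<^bsub>G\<^esub> s" by (simp_all add: adj sc_in E)
    show "c\<^sub>1 \<rightarrow>\<^bsub>G\<^esub> b i" "c\<^sub>2 \<rightarrow>\<^bsub>G\<^esub> b i" if "0 < i" "i < Suc d" for i
      using that by (auto simp: adj b_in sc_in E)
    show "\<not> c\<^sub>1 \<rightarrow>\<^bsub>G\<^esub> b (Suc d)" "\<not> c\<^sub>2 \<rightarrow>\<^bsub>G\<^esub> b 0"
      using disj(1) by (auto simp: adj b_in sc_in E neq b_eq lr)
  qed (use d in simp)
  moreover have "B = b ` {1..<Suc d}" using B by (simp add: atLeastLessThanSuc_atLeastAtMost)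
  ultimately show ?thesis by blast
qed

section \<open>Propagation through the component\<close>

theorem theorem5p3:
  fixes G W K :: "('a,'b) pre_digraph" and s :: 'a and B C M :: "'a set"
  assumes "graph G" and "prereduced G"
    and "induced_subgraph W G"
    and "(\<exists>c l r. dagger_AW W s c l B r) \<or> (\<exists>c\<^sub>1 c\<^sub>2 l r. ddagger_AW W s c\<^sub>1 c\<^sub>2 l B r)"
    and "C = neighbourhood G {s} \<inter> neighbourhood G B"
    and "is_component (G \<restriction> (verts G - C)) K" and "s \<in> verts K" and "M = verts K"
  shows "(\<forall>m \<in> M. \<forall>x \<in> C. m \<rightarrow>\<^bsub>G\<^esub> x) \<and> is_clique (G \<restriction> C)"
proof -
  interpret prereduced_graph G
    using assms(1,2) by (simp add: prereduced_graph_def prereduced_graph_axioms_def)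
  from assms(4) have "\<exists>b n cl cr. AW_frame G s b n cl cr \<and> B = b ` {1..<n}"
  proof
    assume "\<exists>c l r. dagger_AW W s c l B r"
    then obtain c l r where "dagger_AW W s c l B r" by blast
    from dagger_frame[OF assms(3) this] show ?thesis by blast
  next
    assume "\<exists>c\<^sub>1 c\<^sub>2 l r. ddagger_AW W s c\<^sub>1 c\<^sub>2 l B r"
    then obtain c\<^sub>1 c\<^sub>2 l r where "ddagger_AW W s c\<^sub>1 c\<^sub>2 l B r" by blast
    from ddagger_frame[OF assms(3) this] show ?thesis by blast
  qed
  then obtain b n cl cr where frame: "AW_frame G s b n cl cr" and B: "B = b ` {1..<n}"
    by blast
  interpret AW_frame G s b n cl cr by (rule frame)
  have C: "C = common_nbrs" using assms(5) B by (simp add: common_nbrs_def)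
  let ?H = "G \<restriction> (verts G - C)"
  have "subgraph K ?H" "connected K"
    using assms(6) by (auto simp: is_component_def pre_digraph.max_subgraph_def)
  have K_verts: "verts K \<subseteq> verts G - C" using \<open>subgraph K ?H\<close> by (auto simp: subgraph_def)
  have K_adj: "u \<rightarrow>\<^bsub>G\<^esub> v" if "u \<rightarrow>\<^bsub>K\<^esub> v" for u v
  proof -
    have "u \<rightarrow>\<^bsub>?H\<^esub> v" using arcs_ends_mono[OF \<open>subgraph K ?H\<close>] that by blast
    then show ?thesis by (simp add: adj_induce_subgraph_iff)
  qed
  \<comment> \<open>The invariant for the induction along a walk from \<open>s\<close>: path and
    centres stay fixed, only the terminal moves, and the common neighbours remain
    \<open>C\<close>.\<close>
  have "AW_frame G m b n cl cr \<and> AW_frame.common_nbrs G m b n = C"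
    if "m \<in> verts K" for m
  proof -
    have "s \<rightarrow>\<^sup>*\<^bsub>mk_symmetric K\<^esub> m"
      using \<open>connected K\<close> assms(7) that by (auto simp: connected_def strongly_connected_def)
    then have "(s, m) \<in> rtrancl_on (verts K) (parcs (mk_symmetric K))"
      by (simp add: reachable_def)
    then show ?thesis
    proof (induction rule: rtrancl_on_induct)
      case base
      show ?case using frame C by simp
    next
      case (step u v)
      interpret u: AW_frame G u b n cl cr using step.IH by simp
      \<comment> \<open>\<open>connected\<close> is reachability in the symmetric closure of
        \<open>K\<close>, so a step may run against an arc of \<open>K\<close>; symmetry of
        \<open>G\<close> then turns it round.\<close>
      have "u \<rightarrow>\<^bsub>K\<^esub> v \<or> v \<rightarrow>\<^bsub>K\<^esub> u" using step.hyps by (auto simp: parcs_mk_symmetric arcs_ends_conv)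
      then have "u \<rightarrow>\<^bsub>G\<^esub> v" using K_adj adj_symD by blast
      moreover have "v \<notin> u.common_nbrs" using step K_verts by auto
      ultimately show ?case using u.shift_terminal u.shift_common_nbrs step.IH by simp
    qed
  qed
  \<comment> \<open>With \<open>m\<close> as terminal, \<open>C\<close> consists of neighbours of
    \<open>m\<close>.\<close>
  then have "m \<rightarrow>\<^bsub>G\<^esub> x" if "m \<in> verts K" "x \<in> C" for m x
    using that AW_frame.common_nbrs_iff by metis
  moreover have "is_clique (G \<restriction> C)"
    unfolding is_clique_def
  proof (intro ballI impI)
    fix u v assume "u \<in> verts (G \<restriction> C)" "v \<in> verts (G \<restriction> C)" "u \<noteq> v"
    then have "u \<in> C" "v \<in> C" by auto
    moreover from this have "u \<rightarrow>\<^bsub>G\<^esub> v"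
      using common_nbrs_absorb[of v u] common_nbrs_iff \<open>u \<noteq> v\<close> C by blast
    ultimately show "u \<rightarrow>\<^bsub>G \<restriction> C\<^esub> v" by (simp add: adj_induce_subgraph_iff)
  qed
  ultimately show ?thesis using assms(8) by blast
qed

end
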